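(* Let $\mathcal{X}$ be a category and $\mathcal{M}$ a class of morphisms of $\mathcal{X}$ such that $\mathcal{X}$ has quasi right $\mathcal{M}$-factorizations, and let $\mathbf{C}$ be a closure operator on $\mathcal{X}$ with respect to $\mathcal{M}$. Suppose that every morphism in $\mathcal{M}$ is a quasi mono, that $\mathcal{M}$ is closed under composition, and that $\mathcal{E}^{QC}\subseteq{}^{\triangle(\mathcal{E}^{QC})}\mathcal{M}$. Then $\mathcal{X}$ has quasi left $\mathcal{E}^{QC}$-factorizations.
   Context: For a class $\mathcal{M}$ of morphisms and an object $X$, $\mathcal{M}/X$ is the class of all morphisms in $\mathcal{M}$ with codomain $X$. For a morphism $f$, $\langle f\rangle=\{fh : h\in\mathcal{X},\ fh\text{ defined}\}$. For morphisms $f,g$ with the same codomain, $f\leqslant g$ means $\langle f\rangle\subseteq\langle g\rangle$ (equivalently $f=gj$ for some $j$), and $f\sim g$ means $f\leqslant g$ and $g\leqslant f$. $\mathcal{X}$ has quasi right $\mathcal{M}$-factorizations if for every morphism $f:Y\to X$ there is $m_f\in\mathcal{M}/X$ (called a quasi right part of $f$) such that (a) $f=m_fg$ for some $g$; (b) if $m\in\mathcal{M}/X$ and $f=mg$ for some $g$, then $m_f=mh$ for some $h$. A quasi right part is determined up to $\sim$. Dually, $\mathcal{X}$ has quasi left $\mathcal{E}$-factorizations if for every morphism $f:Y\to X$ there is $e_f\in\mathcal{E}$ with domain $Y$ such that (a) $f=ge_f$ for some $g$; (b) if $e\in\mathcal{E}$ has domain $Y$ and $f=ge$ for some $g$, then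 $e_f=he$ for some $h$. A morphism $f$ is a quasi mono if $fa=fb$ implies $\langle a\rangle=\langle b\rangle$ for all morphisms $a,b$. A (general) closure operator $\mathbf{C}=(\mathbf{c}_X)_{X\in\mathcal{X}}$ on $\mathcal{X}$ with respect to $\mathcal{M}$ (where $\mathcal{X}$ has quasi right $\mathcal{M}$-factorizations) is a family of maps $\mathbf{c}_X:\mathcal{M}/X\to\mathcal{M}/X$ such that: (a) $m\leqslant\mathbf{c}_X(m)$ for all $m\in\mathcal{M}/X$; (b) if $m\leqslant m'$ in $\mathcal{M}/X$ then $\mathbf{c}_X(m)\leqslant\mathbf{c}_X(m')$; (c) for every $f:X\to Y$ and $m\in\mathcal{M}/X$, $m_{f\mathbf{c}_X(m)}\leqslant\mathbf{c}_Y(m_{fm})$. $m\in\mathcal{M}/X$ is quasi $\mathbf{C}$-dense if $\mathbf{c}_X(m)\sim 1_X$. An arbitrary morphism $f$ is quasi $\mathbf{C}$-dense if $m_f$ is quasi $\mathbf{C}$-dense; $\mathcal{E}^{QC}$ is the class of all quasi $\mathbf{C}$-dense morphisms of $\mathcal{X}$. For a class $\mathcal{E}$ of morphisms, ${}^{\triangle\mathcal{E}}\mathcal{M}$ denotes the class of all $e'\in\mathcal{E}$ such that for all $e\in\mathcal{E}$, $m\in\mathcal{M}$ and every morphism $k$ with $me=ke'$ (composites defined), there is a morphism $d$ with $e=de'$. *)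

theory Defs
  imports Main "HOL-Library.FuncSet"
begin

record ('o, 'm) cat =
  Obj :: "'o set"
  Mor :: "'m set"
  Dom :: "'m \<Rightarrow> 'o"
  Cod :: "'m \<Rightarrow> 'o"
  Id :: "'o \<Rightarrow> 'm"
  Comp :: "'m \<Rightarrow> 'm \<Rightarrow> 'm"  (infixr "\<cdot>\<index>" 70)

text \<open>Composition is written in the usual order and is only meaningful on composable
  pairs of morphisms: values elsewhere are unconstrained.\<close>

definition composable :: "('o, 'm, 'z) cat_scheme \<Rightarrow> 'm \<Rightarrow> 'm \<Rightarrow> bool" where
  "composable X g f \<longleftrightarrow> g \<in> Mor X \<and> f \<in> Mor X \<and> Dom X g = Cod X f"

locale category =
  fixes X :: "('o, 'm, 'z) cat_scheme" (structure)
  assumes Dom_in: "f \<in> Mor X \<Longrightarrow> Dom X f \<in> Obj X"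
    and Cod_in: "f \<in> Mor X \<Longrightarrow> Cod X f \<in> Obj X"
    and Id_in: "A \<in> Obj X \<Longrightarrow> Id X A \<in> Mor X"
    and Dom_Id: "A \<in> Obj X \<Longrightarrow> Dom X (Id X A) = A"
    and Cod_Id: "A \<in> Obj X \<Longrightarrow> Cod X (Id X A) = A"
    and Comp_in: "composable X g f \<Longrightarrow> g \<cdot> f \<in> Mor X"
    and Dom_Comp: "composable X g f \<Longrightarrow> Dom X (g \<cdot> f) = Dom X f"
    and Cod_Comp: "composable X g f \<Longrightarrow> Cod X (g \<cdot> f) = Cod X g"
    and Comp_Id: "f \<in> Mor X \<Longrightarrow> f \<cdot> Id X (Dom X f) = f"
    and Id_Comp: "f \<in> Mor X \<Longrightarrow> Id X (Cod X f) \<cdot> f = f"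
    and Comp_assoc: "composable X h g \<Longrightarrow> composable X g f \<Longrightarrow> (h \<cdot> g) \<cdot> f = h \<cdot> (g \<cdot> f)"

definition over :: "('o, 'm, 'z) cat_scheme \<Rightarrow> 'm set \<Rightarrow> 'o \<Rightarrow> 'm set" where
  "over X M A = {m \<in> M. Cod X m = A}"

definition sieve :: "('o, 'm, 'z) cat_scheme \<Rightarrow> 'm \<Rightarrow> 'm set" where
  "sieve X f = {f \<cdot>\<^bsub>X\<^esub> h | h. composable X f h}"

text \<open>The preorder is meant for morphisms with a common codomain; on morphisms of a
  category, the inclusion of sieves already forces the codomains to agree.\<close>

definition below :: "('o, 'm, 'z) cat_scheme \<Rightarrow> 'm \<Rightarrow> 'm \<Rightarrow> bool" where
  "below X f g \<longleftrightarrow> sieve X f \<subseteq> sieve X g"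

definition equiv_mor :: "('o, 'm, 'z) cat_scheme \<Rightarrow> 'm \<Rightarrow> 'm \<Rightarrow> bool" where
  "equiv_mor X f g \<longleftrightarrow> below X f g \<and> below X g f"

definition is_quasi_right_part ::
    "('o, 'm, 'z) cat_scheme \<Rightarrow> 'm set \<Rightarrow> 'm \<Rightarrow> 'm \<Rightarrow> bool" where
  "is_quasi_right_part X M f n \<longleftrightarrow>
     n \<in> over X M (Cod X f) \<and>
     (\<exists>g. composable X n g \<and> f = n \<cdot>\<^bsub>X\<^esub> g) \<and>
     (\<forall>m \<in> over X M (Cod X f). (\<exists>g. composable X m g \<and> f = m \<cdot>\<^bsub>X\<^esub> g) \<longrightarrow>
        (\<exists>h. composable X m h \<and> n = m \<cdot>\<^bsub>X\<^esub> h))"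

definition has_quasi_right_factorizations ::
    "('o, 'm, 'z) cat_scheme \<Rightarrow> 'm set \<Rightarrow> bool" where
  "has_quasi_right_factorizations X M \<longleftrightarrow>
     (\<forall>f \<in> Mor X. \<exists>n. is_quasi_right_part X M f n)"

text \<open>A chosen representative of the quasi right parts of \<open>f\<close>, which are unique up to
  \<open>equiv_mor\<close> (lemma \<open>quasi_right_part_unique\<close> below).\<close>

definition quasi_right_part :: "('o, 'm, 'z) cat_scheme \<Rightarrow> 'm set \<Rightarrow> 'm \<Rightarrow> 'm" where
  "quasi_right_part X M f = (SOME n. is_quasi_right_part X M f n)"

definition is_quasi_left_part ::
    "('o, 'm, 'z) cat_scheme \<Rightarrow> 'm set \<Rightarrow> 'm \<Rightarrow> 'm \<Rightarrow> bool" where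
  "is_quasi_left_part X E f p \<longleftrightarrow>
     p \<in> E \<and> Dom X p = Dom X f \<and>
     (\<exists>g. composable X g p \<and> f = g \<cdot>\<^bsub>X\<^esub> p) \<and>
     (\<forall>e \<in> E. Dom X e = Dom X f \<longrightarrow> (\<exists>g. composable X g e \<and> f = g \<cdot>\<^bsub>X\<^esub> e) \<longrightarrow>
        (\<exists>h. composable X h e \<and> p = h \<cdot>\<^bsub>X\<^esub> e))"

definition has_quasi_left_factorizations ::
    "('o, 'm, 'z) cat_scheme \<Rightarrow> 'm set \<Rightarrow> bool" where
  "has_quasi_left_factorizations X E \<longleftrightarrow>
     (\<forall>f \<in> Mor X. \<exists>p. is_quasi_left_part X E f p)"

definition quasi_mono :: "('o, 'm, 'z) cat_scheme \<Rightarrow> 'm \<Rightarrow> bool" where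
  "quasi_mono X f \<longleftrightarrow> f \<in> Mor X \<and>
     (\<forall>a b. composable X f a \<and> composable X f b \<and> f \<cdot>\<^bsub>X\<^esub> a = f \<cdot>\<^bsub>X\<^esub> b
        \<longrightarrow> sieve X a = sieve X b)"

definition closed_under_composition :: "('o, 'm, 'z) cat_scheme \<Rightarrow> 'm set \<Rightarrow> bool" where
  "closed_under_composition X M \<longleftrightarrow>
     (\<forall>m \<in> M. \<forall>n \<in> M. composable X m n \<longrightarrow> m \<cdot>\<^bsub>X\<^esub> n \<in> M)"

definition closure_operator ::
    "('o, 'm, 'z) cat_scheme \<Rightarrow> 'm set \<Rightarrow> ('o \<Rightarrow> 'm \<Rightarrow> 'm) \<Rightarrow> bool" where
  "closure_operator X M c \<longleftrightarrow>
     (\<forall>A \<in> Obj X. c A \<in> over X M A \<rightarrow> over X M A) \<and>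
     (\<forall>A \<in> Obj X. \<forall>m \<in> over X M A. below X m (c A m)) \<and>
     (\<forall>A \<in> Obj X. \<forall>m \<in> over X M A. \<forall>m' \<in> over X M A.
        below X m m' \<longrightarrow> below X (c A m) (c A m')) \<and>
     (\<forall>f \<in> Mor X. \<forall>m \<in> over X M (Dom X f).
        below X (quasi_right_part X M (f \<cdot>\<^bsub>X\<^esub> c (Dom X f) m))
                (c (Cod X f) (quasi_right_part X M (f \<cdot>\<^bsub>X\<^esub> m))))"

text \<open>Density of a member \<open>m\<close> of \<open>M\<close>, and then density of an arbitrary morphism through
  its quasi right part.\<close>

definition quasi_dense_in ::
    "('o, 'm, 'z) cat_scheme \<Rightarrow> ('o \<Rightarrow> 'm \<Rightarrow> 'm) \<Rightarrow> 'm \<Rightarrow> bool" where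
  "quasi_dense_in X c m \<longleftrightarrow> equiv_mor X (c (Cod X m) m) (Id X (Cod X m))"

definition quasi_dense_class ::
    "('o, 'm, 'z) cat_scheme \<Rightarrow> 'm set \<Rightarrow> ('o \<Rightarrow> 'm \<Rightarrow> 'm) \<Rightarrow> 'm set" where
  "quasi_dense_class X M c = {f \<in> Mor X. quasi_dense_in X c (quasi_right_part X M f)}"

definition triangle_class ::
    "('o, 'm, 'z) cat_scheme \<Rightarrow> 'm set \<Rightarrow> 'm set \<Rightarrow> 'm set" where
  "triangle_class X E M = {e' \<in> E. \<forall>e \<in> E. \<forall>m \<in> M. \<forall>k.
     composable X m e \<and> composable X k e' \<and> m \<cdot>\<^bsub>X\<^esub> e = k \<cdot>\<^bsub>X\<^esub> e'
       \<longrightarrow> (\<exists>d. composable X d e' \<and> e = d \<cdot>\<^bsub>X\<^esub> e')}"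

context category
begin

lemma below_iff:
  assumes "f \<in> Mor X" "g \<in> Mor X"
  shows "below X f g \<longleftrightarrow> (\<exists>j. composable X g j \<and> f = g \<cdot> j)"
proof
  assume *: "below X f g"
  have "composable X f (Id X (Dom X f))"
    using assms by (simp add: composable_def Dom_in Id_in Cod_Id)
  then have "f \<in> sieve X f"
    using Comp_Id[OF assms(1)] by (force simp: sieve_def)
  with * show "\<exists>j. composable X g j \<and> f = g \<cdot> j"
    by (auto simp: below_def sieve_def)
next
  assume "\<exists>j. composable X g j \<and> f = g \<cdot> j"
  then obtain j where j: "composable X g j" "f = g \<cdot> j" by blast
  show "below X f g"
    unfolding below_def
  proof
    fix x assume "x \<in> sieve X f"
    then obtain h where h: "composable X f h" "x = f \<cdot> h" by (auto simp: sieve_def)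
    have jh: "composable X j h"
      using j h Dom_Comp[OF j(1)] by (simp add: composable_def)
    then have "composable X g (j \<cdot> h)"
      using j(1) Comp_in[OF jh] Cod_Comp[OF jh] by (simp add: composable_def)
    moreover have "x = g \<cdot> (j \<cdot> h)"
      using h(2) j jh Comp_assoc by simp
    ultimately show "x \<in> sieve X g" by (auto simp: sieve_def)
  qed
qed

lemma quasi_right_part_unique:
  assumes "is_quasi_right_part X M f n" "is_quasi_right_part X M f n'"
  shows "equiv_mor X n n'"
proof -
  have "n \<in> Mor X" "n' \<in> Mor X"
    using assms by (auto simp: is_quasi_right_part_def composable_def)
  then show ?thesis
    using assms unfolding equiv_mor_def is_quasi_right_part_def by (simp add: below_iff)
qed

end

end

theory Submission imports Defs begin

text \<open>Every morphism \<open>f\<close> is \<open>n \<cdot> g\<close> for a quasi right part \<open>n \<in> M\<close>, and the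
  cofactor \<open>g\<close> is automatically dense. Indeed, if \<open>g = r \<cdot> h\<close> with \<open>r \<in> M\<close>, then \<open>f\<close>
  factors through \<open>n \<cdot> r\<close>, which lies in \<open>M\<close> because \<open>M\<close> is closed under composition;
  so \<open>n\<close> itself factors through \<open>n \<cdot> r\<close>, and cancelling the quasi mono \<open>n\<close> makes \<open>r\<close>
  equivalent to an identity (\<open>identity_below_part_of_cofactor\<close>). Since
  \<open>r \<le> c r\<close>, the closure of \<open>r\<close> is then equivalent to an identity as well, which is
  the density of \<open>g\<close> (\<open>quasi_dense_in_if_identity_below\<close>).

  Hence \<open>f = n \<cdot> g\<close> with \<open>n \<in> M\<close> and \<open>g\<close> dense. For any other factorization
  \<open>f = k \<cdot> e\<close> with \<open>e\<close> dense, the triangle property of \<open>e\<close>, applied to the square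
  \<open>n \<cdot> g = k \<cdot> e\<close>, factors \<open>g\<close> through \<open>e\<close>. This is precisely what makes \<open>g\<close> a quasi
  left part of \<open>f\<close>.\<close>

lemma quasi_right_part_is_quasi_right_part:
  assumes "has_quasi_right_factorizations X M" "f \<in> Mor X"
  shows "is_quasi_right_part X M f (quasi_right_part X M f)"
  using assms unfolding has_quasi_right_factorizations_def quasi_right_part_def
  by (blast intro: someI_ex)

context category
begin

lemma below_identity:
  assumes "m \<in> Mor X"
  shows "below X m (Id X (Cod X m))"
  using assms
  by (auto simp: below_iff Id_in Cod_in composable_def Dom_Id Id_Comp intro!: exI[of _ m])

text \<open>This is the quasi version of the fact that the cofactor of a right
  \<open>M\<close>-factorization is \<open>M\<close>-extremal. A quasi mono \<open>n\<close> does not cancel to an equality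
  \<open>r \<cdot> t = 1\<close>, only to an equality of sieves, but that is all that \<open>1 \<le> r\<close> asks for.\<close>

lemma identity_below_part_of_cofactor:
  assumes comp: "closed_under_composition X M"
    and n: "is_quasi_right_part X M f n" "quasi_mono X n"
    and g: "composable X n g" "f = n \<cdot> g"
    and r: "is_quasi_right_part X M g r"
  shows "below X (Id X (Cod X g)) r"
proof -
  from r obtain h where rM: "r \<in> M" "Cod X r = Cod X g"
      and h: "composable X r h" "g = r \<cdot> h"
    unfolding is_quasi_right_part_def over_def by auto
  have nr: "composable X n r"
    using g(1) h(1) rM(2) by (simp add: composable_def)
  have nr_M: "n \<cdot> r \<in> over X M (Cod X f)"
    using comp n(1) rM(1) nr g Cod_Comp[OF nr] Cod_Comp[OF g(1)]
    by (auto simp: closed_under_composition_def is_quasi_right_part_def over_def)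
  have "composable X (n \<cdot> r) h" "f = (n \<cdot> r) \<cdot> h"
    using nr h g(2) Comp_in[OF nr] Dom_Comp[OF nr] Comp_assoc[OF nr h(1)]
    by (auto simp: composable_def)
  with n(1) nr_M obtain t where t: "composable X (n \<cdot> r) t" "n = (n \<cdot> r) \<cdot> t"
    unfolding is_quasi_right_part_def by blast
  have rt: "composable X r t"
    using t(1) nr Dom_Comp[OF nr] by (simp add: composable_def)
  have n_rt: "composable X n (r \<cdot> t)"
    using nr Comp_in[OF rt] Cod_Comp[OF rt] by (simp add: composable_def)
  have n_Id: "composable X n (Id X (Dom X n))"
    using nr Dom_in[of n] by (auto simp: composable_def Id_in Cod_Id)
  have "n \<cdot> Id X (Dom X n) = n \<cdot> (r \<cdot> t)"
    using t(2) Comp_assoc[OF nr rt] Comp_Id[of n] nr unfolding composable_def by metis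
  then have "sieve X (Id X (Dom X n)) = sieve X (r \<cdot> t)"
    using n(2) n_Id n_rt unfolding quasi_mono_def by blast
  moreover have "below X (r \<cdot> t) r"
    using rt Comp_in[OF rt] by (auto simp: below_iff composable_def)
  ultimately show ?thesis
    using g(1) by (simp add: below_def composable_def)
qed

lemma quasi_dense_in_if_identity_below:
  assumes "M \<subseteq> Mor X" "closure_operator X M c" "m \<in> M" "below X (Id X (Cod X m)) m"
  shows "quasi_dense_in X c m"
proof -
  have A: "Cod X m \<in> Obj X" "m \<in> over X M (Cod X m)"
    using assms(1,3) Cod_in by (auto simp: over_def)
  then have cm: "c (Cod X m) m \<in> over X M (Cod X m)" and "below X m (c (Cod X m) m)"
    using assms(2) by (auto simp: closure_operator_def)
  then have "below X (Id X (Cod X m)) (c (Cod X m) m)"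
    using assms(4) by (auto simp: below_def)
  moreover have "below X (c (Cod X m) m) (Id X (Cod X m))"
    using below_identity[of "c (Cod X m) m"] cm assms(1) by (auto simp: over_def)
  ultimately show ?thesis
    by (simp add: quasi_dense_in_def equiv_mor_def)
qed

end

theorem theorem4p11:
  fixes X :: "('o, 'm) cat" and M :: "'m set" and c :: "'o \<Rightarrow> 'm \<Rightarrow> 'm"
  assumes "category X"
    and "M \<subseteq> Mor X"
    and "has_quasi_right_factorizations X M"
    and "closure_operator X M c"
    and "\<forall>m \<in> M. quasi_mono X m"
    and "closed_under_composition X M"
    and "quasi_dense_class X M c \<subseteq> triangle_class X (quasi_dense_class X M c) M"
  shows "has_quasi_left_factorizations X (quasi_dense_class X M c)"
  unfolding has_quasi_left_factorizations_def
proof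
  interpret category X by fact
  let ?E = "quasi_dense_class X M c"
  fix f assume "f \<in> Mor X"
  then obtain n where n: "is_quasi_right_part X M f n"
    using assms(3) unfolding has_quasi_right_factorizations_def by blast
  then obtain g where nM: "n \<in> M" and g: "composable X n g" "f = n \<cdot>\<^bsub>X\<^esub> g"
    unfolding is_quasi_right_part_def over_def by auto
  have gX: "g \<in> Mor X"
    using g(1) by (simp add: composable_def)
  let ?r = "quasi_right_part X M g"
  have r: "is_quasi_right_part X M g ?r"
    using quasi_right_part_is_quasi_right_part[OF assms(3) gX] .
  then have rM: "?r \<in> M" "Cod X ?r = Cod X g"
    by (auto simp: is_quasi_right_part_def over_def)
  have "below X (Id X (Cod X g)) ?r"
    using identity_below_part_of_cofactor[OF assms(6) n _ g r] assms(5) nM by blast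
  then have gE: "g \<in> ?E"
    using quasi_dense_in_if_identity_below[OF assms(2,4) rM(1)] rM(2) gX
    by (simp add: quasi_dense_class_def)
  have "\<exists>d. composable X d e \<and> g = d \<cdot>\<^bsub>X\<^esub> e"
    if "e \<in> ?E" "composable X k e" "f = k \<cdot>\<^bsub>X\<^esub> e" for e k
  proof -
    have "e \<in> triangle_class X ?E M"
      using that(1) assms(7) by blast
    moreover have "n \<cdot>\<^bsub>X\<^esub> g = k \<cdot>\<^bsub>X\<^esub> e"
      using g(2) that(3) by simp
    ultimately show ?thesis
      using gE nM g(1) that(2) unfolding triangle_class_def by blast
  qed
  then have "is_quasi_left_part X ?E f g"
    using gE g Dom_Comp[OF g(1)] unfolding is_quasi_left_part_def by auto
  then show "\<exists>p. is_quasi_left_part X ?E f p" ..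
qed

end
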